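(* Let $(M,\rho,T_M)$ be a representation of a Rota-Baxter $3$-Lie algebra $(\mathfrak g,[\cdot,\cdot,\cdot],T)$ of weight $\lambda$, and let $\psi:\wedge^3\mathfrak g\to M$ and $\chi:\mathfrak g\to M$ be linear maps. Define on $\mathfrak g\oplus M$ a ternary operation and a linear operator by $$[x+m,y+n,z+q]_\psi=[x,y,z]+\rho(x,y)q+\rho(z,x)n+\rho(y,z)m+\psi(x,y,z),\qquad T_\chi(x+m)=T(x)+\chi(x)+T_M(m),$$ for $x,y,z\in\mathfrak g$, $m,n,q\in M$. Then $(\mathfrak g\oplus M,[\cdot,\cdot,\cdot]_\psi,T_\chi)$ is a Rota-Baxter $3$-Lie algebra of weight $\lambda$ if and only if $(\psi,\chi)$ is a $2$-cocycle in the cochain complex of the Rota-Baxter $3$-Lie algebra $(\mathfrak g,[\cdot,\cdot,\cdot],T)$ with coefficients in $(M,\rho,T_M)$. In this case, the canonical inclusion and projection give an abelian extension $$0\to(M,0,T_M)\to(\mathfrak g\oplus M,[\cdot,\cdot,\cdot]_\psi,T_\chi)\to(\mathfrak g,[\cdot,\cdot,\cdot],T)\to0,$$ and the canonical section $s:\mathfrak g\to\mathfrak g\oplus M$, $s(x)=x$, endows $M$ with the original representation, i.e. $[s(x),s(y),m]_\psi=\rho(x,y)m$ for all $x,y\in\mathfrak g$, $m\in M$.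
   Context: Let $k$ be a field of characteristic $0$; vector spaces are over $k$; $\lambda\in k$. A $3$-Lie algebra is a vector space $\mathfrak g$ with a linear map $[\cdot,\cdot,\cdot]:\wedge^3\mathfrak g\to\mathfrak g$ such that $[x_1,x_2,[x_3,x_4,x_5]]=[[x_1,x_2,x_3],x_4,x_5]+[x_3,[x_1,x_2,x_4],x_5]+[x_3,x_4,[x_1,x_2,x_5]]$. A representation on $M$ is a linear map $\rho:\wedge^2\mathfrak g\to\mathfrak{gl}(M)$ with $\rho(x_1,x_2)\rho(x_3,x_4)=\rho([x_1,x_2,x_3],x_4)+\rho(x_3,[x_1,x_2,x_4])+\rho(x_3,x_4)\rho(x_1,x_2)$ and $\rho(x_1,[x_2,x_3,x_4])=\rho(x_3,x_4)\rho(x_1,x_2)-\rho(x_2,x_4)\rho(x_1,x_3)+\rho(x_2,x_3)\rho(x_1,x_4)$. A Rota-Baxter $3$-Lie algebra of weight $\lambda$ is a $3$-Lie algebra with a linear map $T:\mathfrak g\to\mathfrak g$ such that $[T(x),T(y),T(z)]=T([x,y,z]_T)$, where $[x,y,z]_T:=[T(x),T(y),z]+[T(x),y,T(z)]+[x,T(y),T(z)]+\lambda[T(x),y,z]+\lambda[x,T(y),z]+\lambda[x,y,T(z)]+\lambda^2[x,y,z]$. Morphisms are $3$-Lie algebra homomorphisms commuting with the operators. A representation is a triple $(M,\rho,T_M)$ with $(M,\rho)$ a representation of the $3$-Lie algebra and $T_M\in\mathrm{End}(M)$ satisfying $\rho(T(x),T(y))T_M(m)=T_M\big(\rho(T(x),T(y))m+\rho(T(x),y)T_M(m)+\rho(x,T(y))T_M(m)+\lambda\rho(T(x),y)m+\lambda\rho(x,T(y))m+\lambda\rho(x,y)T_M(m)+\lambda^2\rho(x,y)m\big)$.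 A vector space $M$ with $T_M\in\mathrm{End}(M)$ is regarded as a Rota-Baxter $3$-Lie algebra $(M,0,T_M)$ with zero bracket. An abelian extension of $(\mathfrak g,[\cdot,\cdot,\cdot],T)$ by $(M,0,T_M)$ is a short exact sequence $0\to M\xrightarrow{i}\hat{\mathfrak g}\xrightarrow{p}\mathfrak g\to0$ of morphisms of Rota-Baxter $3$-Lie algebras of weight $\lambda$ such that $[u,i(m),i(n)]_{\hat{\mathfrak g}}=0$ for all $u\in\hat{\mathfrak g}$, $m,n\in M$. 2-cocycles. Put $\rho_T(x,y)m=\rho(T(x),T(y))m-T_M\big(\rho(T(x),y)m+\rho(x,T(y))m+\lambda\rho(x,y)m\big)$. The $2$-cochains are $\mathrm{Hom}(\wedge^3\mathfrak g,M)\oplus\mathrm{Hom}(\mathfrak g,M)$ with $d^2(f,g)=(\delta^2f,-\partial^1g-\Phi^2f)$, where $(\delta^2f)(x_1,\dots,x_5)=-f([x_1,x_2,x_3],x_4,x_5)-f(x_3,[x_1,x_2,x_4],x_5)-f(x_3,x_4,[x_1,x_2,x_5])+f(x_1,x_2,[x_3,x_4,x_5])+\rho(x_1,x_2)f(x_3,x_4,x_5)-\rho(x_3,x_4)f(x_1,x_2,x_5)-\rho(x_4,x_5)f(x_1,x_2,x_3)-\rho(x_5,x_3)f(x_1,x_2,x_4)$; $(\partial^1g)(x,y,z)=-g([x,y,z]_T)+\rho_T(x,y)g(z)+\rho_T(y,z)g(x)+\rho_T(z,x)g(y)$; $(\Phi^2f)(x,y,z)=f(T(x),T(y),T(z))-T_M\big(f(T(x),T(y),z)+f(T(x),y,T(z))+f(x,T(y),T(z))+\lambda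 f(T(x),y,z)+\lambda f(x,T(y),z)+\lambda f(x,y,T(z))+\lambda^2f(x,y,z)\big)$. A $2$-cocycle is a pair $(f,g)$ with $d^2(f,g)=0$. *)

theory Defs
  imports "HOL-Analysis.Product_Vector"
begin

text \<open>
  Vector spaces are types carrying an explicit scalar multiplication by a field of
  characteristic 0 (locale \<^locale>\<open>vector_space\<close>). Linear maps out of an exterior power are
  represented by alternating multilinear maps.
\<close>

definition alternating2 ::
  "('k::field_char_0 \<Rightarrow> 'v::ab_group_add \<Rightarrow> 'v) \<Rightarrow> ('k \<Rightarrow> 'w::ab_group_add \<Rightarrow> 'w) \<Rightarrow>
   ('v \<Rightarrow> 'v \<Rightarrow> 'w) \<Rightarrow> bool"
where
  "alternating2 s1 s2 f \<longleftrightarrow>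
     (\<forall>y. Vector_Spaces.linear s1 s2 (\<lambda>x. f x y)) \<and>
     (\<forall>x. Vector_Spaces.linear s1 s2 (\<lambda>y. f x y)) \<and>
     (\<forall>x. f x x = 0)"

definition alternating3 ::
  "('k::field_char_0 \<Rightarrow> 'v::ab_group_add \<Rightarrow> 'v) \<Rightarrow> ('k \<Rightarrow> 'w::ab_group_add \<Rightarrow> 'w) \<Rightarrow>
   ('v \<Rightarrow> 'v \<Rightarrow> 'v \<Rightarrow> 'w) \<Rightarrow> bool"
where
  "alternating3 s1 s2 f \<longleftrightarrow>
     (\<forall>y z. Vector_Spaces.linear s1 s2 (\<lambda>x. f x y z)) \<and>
     (\<forall>x z. Vector_Spaces.linear s1 s2 (\<lambda>y. f x y z)) \<and>
     (\<forall>x y. Vector_Spaces.linear s1 s2 (\<lambda>z. f x y z)) \<and>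
     (\<forall>x y. f x x y = 0 \<and> f x y x = 0 \<and> f x y y = 0)"

locale three_Lie_algebra = vector_space s
  for s :: "'k::field_char_0 \<Rightarrow> 'g::ab_group_add \<Rightarrow> 'g" +
  fixes br :: "'g \<Rightarrow> 'g \<Rightarrow> 'g \<Rightarrow> 'g"
  assumes bracket_alternating: "alternating3 s s br"
    and fundamental_identity:
      "br x1 x2 (br x3 x4 x5) =
         br (br x1 x2 x3) x4 x5 + br x3 (br x1 x2 x4) x5 + br x3 x4 (br x1 x2 x5)"

locale three_Lie_representation =
  three_Lie_algebra s br + M: vector_space sM
  for s :: "'k::field_char_0 \<Rightarrow> 'g::ab_group_add \<Rightarrow> 'g"
    and br :: "'g \<Rightarrow> 'g \<Rightarrow> 'g \<Rightarrow> 'g"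
    and sM :: "'k \<Rightarrow> 'm::ab_group_add \<Rightarrow> 'm" +
  fixes \<rho> :: "'g \<Rightarrow> 'g \<Rightarrow> 'm \<Rightarrow> 'm"
  assumes action_linear: "Vector_Spaces.linear sM sM (\<rho> x y)"
    and action_alternating: "alternating2 s sM (\<lambda>x y. \<rho> x y m)"
    and action_action:
      "\<rho> x1 x2 (\<rho> x3 x4 m) =
         \<rho> (br x1 x2 x3) x4 m + \<rho> x3 (br x1 x2 x4) m + \<rho> x3 x4 (\<rho> x1 x2 m)"
    and action_bracket:
      "\<rho> x1 (br x2 x3 x4) m =
         \<rho> x3 x4 (\<rho> x1 x2 m) - \<rho> x2 x4 (\<rho> x1 x3 m) + \<rho> x2 x3 (\<rho> x1 x4 m)"

definition RB_bracket ::
  "('k::field_char_0 \<Rightarrow> 'g::ab_group_add \<Rightarrow> 'g) \<Rightarrow> ('g \<Rightarrow> 'g \<Rightarrow> 'g \<Rightarrow> 'g) \<Rightarrow>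
   'k \<Rightarrow> ('g \<Rightarrow> 'g) \<Rightarrow> 'g \<Rightarrow> 'g \<Rightarrow> 'g \<Rightarrow> 'g"
where
  "RB_bracket s br l T x y z =
     br (T x) (T y) z + br (T x) y (T z) + br x (T y) (T z)
     + s l (br (T x) y z) + s l (br x (T y) z) + s l (br x y (T z))
     + s (l\<^sup>2) (br x y z)"

locale RB_three_Lie_algebra = three_Lie_algebra s br
  for s :: "'k::field_char_0 \<Rightarrow> 'g::ab_group_add \<Rightarrow> 'g"
    and br :: "'g \<Rightarrow> 'g \<Rightarrow> 'g \<Rightarrow> 'g" +
  fixes l :: 'k and T :: "'g \<Rightarrow> 'g"
  assumes operator_linear: "Vector_Spaces.linear s s T"
    and Rota_Baxter: "br (T x) (T y) (T z) = T (RB_bracket s br l T x y z)"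

locale RB_three_Lie_representation =
  RB_three_Lie_algebra s br l T + three_Lie_representation s br sM \<rho>
  for s :: "'k::field_char_0 \<Rightarrow> 'g::ab_group_add \<Rightarrow> 'g"
    and br :: "'g \<Rightarrow> 'g \<Rightarrow> 'g \<Rightarrow> 'g"
    and l :: 'k and T :: "'g \<Rightarrow> 'g"
    and sM :: "'k \<Rightarrow> 'm::ab_group_add \<Rightarrow> 'm"
    and \<rho> :: "'g \<Rightarrow> 'g \<Rightarrow> 'm \<Rightarrow> 'm" +
  fixes TM :: "'m \<Rightarrow> 'm"
  assumes module_operator_linear: "Vector_Spaces.linear sM sM TM"
    and Rota_Baxter_action:
      "\<rho> (T x) (T y) (TM m) =
         TM (\<rho> (T x) (T y) m + \<rho> (T x) y (TM m) + \<rho> x (T y) (TM m)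
             + sM l (\<rho> (T x) y m) + sM l (\<rho> x (T y) m) + sM l (\<rho> x y (TM m))
             + sM (l\<^sup>2) (\<rho> x y m))"

definition RB_three_Lie_hom ::
  "('k::field_char_0 \<Rightarrow> 'g::ab_group_add \<Rightarrow> 'g) \<Rightarrow> ('g \<Rightarrow> 'g \<Rightarrow> 'g \<Rightarrow> 'g) \<Rightarrow> ('g \<Rightarrow> 'g) \<Rightarrow>
   ('k \<Rightarrow> 'h::ab_group_add \<Rightarrow> 'h) \<Rightarrow> ('h \<Rightarrow> 'h \<Rightarrow> 'h \<Rightarrow> 'h) \<Rightarrow> ('h \<Rightarrow> 'h) \<Rightarrow>
   ('g \<Rightarrow> 'h) \<Rightarrow> bool"
where
  "RB_three_Lie_hom s br T s' br' T' h \<longleftrightarrow>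
     Vector_Spaces.linear s s' h \<and>
     (\<forall>x y z. h (br x y z) = br' (h x) (h y) (h z)) \<and>
     (\<forall>x. h (T x) = T' (h x))"

text \<open>The arguments after the weight \<open>l\<close> are, in order: the kernel \<open>(sM, TM)\<close> with the zero bracket,
  the total space \<open>(sE, brE, TE)\<close>, the quotient \<open>(s, br, T)\<close>, and the two maps.\<close>

definition abelian_extension ::
  "'k::field_char_0 \<Rightarrow>
   ('k \<Rightarrow> 'm::ab_group_add \<Rightarrow> 'm) \<Rightarrow> ('m \<Rightarrow> 'm) \<Rightarrow>
   ('k \<Rightarrow> 'e::ab_group_add \<Rightarrow> 'e) \<Rightarrow> ('e \<Rightarrow> 'e \<Rightarrow> 'e \<Rightarrow> 'e) \<Rightarrow> ('e \<Rightarrow> 'e) \<Rightarrow>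
   ('k \<Rightarrow> 'g::ab_group_add \<Rightarrow> 'g) \<Rightarrow> ('g \<Rightarrow> 'g \<Rightarrow> 'g \<Rightarrow> 'g) \<Rightarrow> ('g \<Rightarrow> 'g) \<Rightarrow>
   ('m \<Rightarrow> 'e) \<Rightarrow> ('e \<Rightarrow> 'g) \<Rightarrow> bool"
where
  "abelian_extension l sM TM sE brE TE s br T i p \<longleftrightarrow>
     RB_three_Lie_algebra sM (\<lambda>_ _ _. 0) l TM \<and>
     RB_three_Lie_algebra sE brE l TE \<and>
     RB_three_Lie_algebra s br l T \<and>
     RB_three_Lie_hom sM (\<lambda>_ _ _. 0) TM sE brE TE i \<and>
     RB_three_Lie_hom sE brE TE s br T p \<and>
     inj i \<and> range i = {u. p u = 0} \<and> surj p \<and>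
     (\<forall>u m n. brE u (i m) (i n) = 0)"

definition RB_action ::
  "('k::field_char_0 \<Rightarrow> 'm::ab_group_add \<Rightarrow> 'm) \<Rightarrow> 'k \<Rightarrow> ('g \<Rightarrow> 'g) \<Rightarrow>
   ('g \<Rightarrow> 'g \<Rightarrow> 'm \<Rightarrow> 'm) \<Rightarrow> ('m \<Rightarrow> 'm) \<Rightarrow> 'g \<Rightarrow> 'g \<Rightarrow> 'm \<Rightarrow> 'm"
where
  "RB_action sM l T \<rho> TM x y m =
     \<rho> (T x) (T y) m - TM (\<rho> (T x) y m + \<rho> x (T y) m + sM l (\<rho> x y m))"

definition delta2 ::
  "('g \<Rightarrow> 'g \<Rightarrow> 'g \<Rightarrow> 'g) \<Rightarrow> ('g \<Rightarrow> 'g \<Rightarrow> 'm::ab_group_add \<Rightarrow> 'm) \<Rightarrow>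
   ('g \<Rightarrow> 'g \<Rightarrow> 'g \<Rightarrow> 'm) \<Rightarrow> 'g \<Rightarrow> 'g \<Rightarrow> 'g \<Rightarrow> 'g \<Rightarrow> 'g \<Rightarrow> 'm"
where
  "delta2 br \<rho> f x1 x2 x3 x4 x5 =
     - f (br x1 x2 x3) x4 x5 - f x3 (br x1 x2 x4) x5 - f x3 x4 (br x1 x2 x5)
     + f x1 x2 (br x3 x4 x5)
     + \<rho> x1 x2 (f x3 x4 x5) - \<rho> x3 x4 (f x1 x2 x5)
     - \<rho> x4 x5 (f x1 x2 x3) - \<rho> x5 x3 (f x1 x2 x4)"

definition partial1 ::
  "('k::field_char_0 \<Rightarrow> 'g::ab_group_add \<Rightarrow> 'g) \<Rightarrow> ('g \<Rightarrow> 'g \<Rightarrow> 'g \<Rightarrow> 'g) \<Rightarrow>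
   'k \<Rightarrow> ('g \<Rightarrow> 'g) \<Rightarrow>
   ('k \<Rightarrow> 'm::ab_group_add \<Rightarrow> 'm) \<Rightarrow> ('g \<Rightarrow> 'g \<Rightarrow> 'm \<Rightarrow> 'm) \<Rightarrow> ('m \<Rightarrow> 'm) \<Rightarrow>
   ('g \<Rightarrow> 'm) \<Rightarrow> 'g \<Rightarrow> 'g \<Rightarrow> 'g \<Rightarrow> 'm"
where
  "partial1 s br l T sM \<rho> TM g x y z =
     - g (RB_bracket s br l T x y z)
     + RB_action sM l T \<rho> TM x y (g z)
     + RB_action sM l T \<rho> TM y z (g x)
     + RB_action sM l T \<rho> TM z x (g y)"

definition Phi2 ::
  "'k::field_char_0 \<Rightarrow> ('g \<Rightarrow> 'g) \<Rightarrow>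
   ('k \<Rightarrow> 'm::ab_group_add \<Rightarrow> 'm) \<Rightarrow> ('m \<Rightarrow> 'm) \<Rightarrow>
   ('g \<Rightarrow> 'g \<Rightarrow> 'g \<Rightarrow> 'm) \<Rightarrow> 'g \<Rightarrow> 'g \<Rightarrow> 'g \<Rightarrow> 'm"
where
  "Phi2 l T sM TM f x y z =
     f (T x) (T y) (T z)
     - TM (f (T x) (T y) z + f (T x) y (T z) + f x (T y) (T z)
           + sM l (f (T x) y z) + sM l (f x (T y) z) + sM l (f x y (T z))
           + sM (l\<^sup>2) (f x y z))"

definition d2 ::
  "('k::field_char_0 \<Rightarrow> 'g::ab_group_add \<Rightarrow> 'g) \<Rightarrow> ('g \<Rightarrow> 'g \<Rightarrow> 'g \<Rightarrow> 'g) \<Rightarrow>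
   'k \<Rightarrow> ('g \<Rightarrow> 'g) \<Rightarrow>
   ('k \<Rightarrow> 'm::ab_group_add \<Rightarrow> 'm) \<Rightarrow> ('g \<Rightarrow> 'g \<Rightarrow> 'm \<Rightarrow> 'm) \<Rightarrow> ('m \<Rightarrow> 'm) \<Rightarrow>
   ('g \<Rightarrow> 'g \<Rightarrow> 'g \<Rightarrow> 'm) \<times> ('g \<Rightarrow> 'm) \<Rightarrow>
   ('g \<Rightarrow> 'g \<Rightarrow> 'g \<Rightarrow> 'g \<Rightarrow> 'g \<Rightarrow> 'm) \<times> ('g \<Rightarrow> 'g \<Rightarrow> 'g \<Rightarrow> 'm)"
where
  "d2 s br l T sM \<rho> TM = (\<lambda>(f, g).
     (delta2 br \<rho> f,
      \<lambda>x y z. - partial1 s br l T sM \<rho> TM g x y z - Phi2 l T sM TM f x y z))"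

definition two_cochains ::
  "('k::field_char_0 \<Rightarrow> 'g::ab_group_add \<Rightarrow> 'g) \<Rightarrow> ('k \<Rightarrow> 'm::ab_group_add \<Rightarrow> 'm) \<Rightarrow>
   (('g \<Rightarrow> 'g \<Rightarrow> 'g \<Rightarrow> 'm) \<times> ('g \<Rightarrow> 'm)) set"
where
  "two_cochains s sM = {f. alternating3 s sM f} \<times> {g. Vector_Spaces.linear s sM g}"

definition two_cocycles ::
  "('k::field_char_0 \<Rightarrow> 'g::ab_group_add \<Rightarrow> 'g) \<Rightarrow> ('g \<Rightarrow> 'g \<Rightarrow> 'g \<Rightarrow> 'g) \<Rightarrow>
   'k \<Rightarrow> ('g \<Rightarrow> 'g) \<Rightarrow>
   ('k \<Rightarrow> 'm::ab_group_add \<Rightarrow> 'm) \<Rightarrow> ('g \<Rightarrow> 'g \<Rightarrow> 'm \<Rightarrow> 'm) \<Rightarrow> ('m \<Rightarrow> 'm) \<Rightarrow>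
   (('g \<Rightarrow> 'g \<Rightarrow> 'g \<Rightarrow> 'm) \<times> ('g \<Rightarrow> 'm)) set"
where
  "two_cocycles s br l T sM \<rho> TM =
     {c \<in> two_cochains s sM.
        d2 s br l T sM \<rho> TM c = (\<lambda>_ _ _ _ _. 0, \<lambda>_ _ _. 0)}"

text \<open>The direct sum is the product type; its scalar multiplication is
  \<^const>\<open>module_prod.scale\<close>.\<close>

definition twisted_bracket ::
  "('g \<Rightarrow> 'g \<Rightarrow> 'g \<Rightarrow> 'g) \<Rightarrow> ('g \<Rightarrow> 'g \<Rightarrow> 'm::ab_group_add \<Rightarrow> 'm) \<Rightarrow>
   ('g \<Rightarrow> 'g \<Rightarrow> 'g \<Rightarrow> 'm) \<Rightarrow> 'g \<times> 'm \<Rightarrow> 'g \<times> 'm \<Rightarrow> 'g \<times> 'm \<Rightarrow> 'g \<times> 'm"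
where
  "twisted_bracket br \<rho> \<psi> = (\<lambda>(x, m) (y, n) (z, q).
     (br x y z, \<rho> x y q + \<rho> z x n + \<rho> y z m + \<psi> x y z))"

definition twisted_operator ::
  "('g \<Rightarrow> 'g) \<Rightarrow> ('m::ab_group_add \<Rightarrow> 'm) \<Rightarrow> ('g \<Rightarrow> 'm) \<Rightarrow> 'g \<times> 'm \<Rightarrow> 'g \<times> 'm"
where
  "twisted_operator T TM \<chi> = (\<lambda>(x, m). (T x, \<chi> x + TM m))"

end

theory Submission
  imports Defs
begin

text \<open>
  The fundamental identity and the Rota-Baxter identity on the direct sum hold in the first
  component, because they hold in the base algebra. In the second component the axioms of the
  representation cancel every term that involves a module element, so the defects of the two
  identities depend only on the first components of the arguments and equal the two components
  of the coboundary of \<open>(\<psi>, \<chi>)\<close> up to sign.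
\<close>

lemma linear_zero:
  assumes "Vector_Spaces.linear s1 s2 f"
  shows "f 0 = 0"
  using assms unfolding Vector_Spaces.linear_iff by (metis add_cancel_right_right)

lemma alternating3_zero_right:
  assumes "alternating3 s1 s2 f"
  shows "f x y 0 = 0"
  using assms linear_zero[of s1 s2 "f x y"] by (simp add: alternating3_def)

text \<open>The pair (\<open>\<psi>\<close>, \<open>\<chi>\<close>) is an arbitrary 2-cochain here;
  no cocycle condition is imposed, so both directions of the equivalence can be argued inside this
  context.\<close>

locale RB_three_Lie_cochain = RB_three_Lie_representation s br l T sM \<rho> TM
  for s :: "'k::field_char_0 \<Rightarrow> 'g::ab_group_add \<Rightarrow> 'g"
    and br :: "'g \<Rightarrow> 'g \<Rightarrow> 'g \<Rightarrow> 'g"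
    and l :: 'k and T :: "'g \<Rightarrow> 'g"
    and sM :: "'k \<Rightarrow> 'm::ab_group_add \<Rightarrow> 'm"
    and \<rho> :: "'g \<Rightarrow> 'g \<Rightarrow> 'm \<Rightarrow> 'm"
    and TM :: "'m \<Rightarrow> 'm" +
  fixes \<psi> :: "'g \<Rightarrow> 'g \<Rightarrow> 'g \<Rightarrow> 'm" and \<chi> :: "'g \<Rightarrow> 'm"
  assumes cochain_alternating: "alternating3 s sM \<psi>"
    and cochain_linear: "Vector_Spaces.linear s sM \<chi>"
begin

sublocale prod: vector_space_prod s sM
  by unfold_locales

abbreviation "sP \<equiv> module_prod.scale s sM"
abbreviation "brP \<equiv> twisted_bracket br \<rho> \<psi>"
abbreviation "TP \<equiv> twisted_operator T TM \<chi>"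

lemma action_add: "\<rho> x y (m + n) = \<rho> x y m + \<rho> x y n"
  and action_scale: "\<rho> x y (sM c m) = sM c (\<rho> x y m)"
  using action_linear[of x y] by (auto simp: Vector_Spaces.linear_iff)

lemma action_zero [simp]: "\<rho> x y 0 = 0"
  using action_add[of x y 0 0] by simp

lemma action_minus: "\<rho> x y (- m) = - \<rho> x y m"
  using action_add[of x y m "- m"] by (simp add: eq_neg_iff_add_eq_0 add.commute)

lemma action_diff: "\<rho> x y (m - n) = \<rho> x y m - \<rho> x y n"
  using action_add[of x y "m - n" n] by (simp add: eq_diff_eq)

lemma action_add_left: "\<rho> (x + x') y m = \<rho> x y m + \<rho> x' y m"
  and action_add_right: "\<rho> x (y + y') m = \<rho> x y m + \<rho> x y' m"
  and action_scale_left: "\<rho> (s c x) y m = sM c (\<rho> x y m)"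
  and action_scale_right: "\<rho> x (s c y) m = sM c (\<rho> x y m)"
  and action_self [simp]: "\<rho> x x m = 0"
  using action_alternating[of m] by (auto simp: alternating2_def Vector_Spaces.linear_iff)

text \<open>Polarization: biadditivity expands the vanishing diagonal value at \<open>x + y\<close>,
  and only the two mixed terms survive.\<close>

lemma action_swap: "\<rho> y x m = - \<rho> x y m"
proof -
  have "\<rho> (x + y) (x + y) m = 0"
    by (rule action_self)
  then show ?thesis
    by (simp only: action_add_left action_add_right) (simp add: eq_neg_iff_add_eq_0 add.commute)
qed

lemma operator_add: "TM (m + n) = TM m + TM n"
  and operator_scale: "TM (sM c m) = sM c (TM m)"
  using module_operator_linear by (auto simp: Vector_Spaces.linear_iff)

text \<open>When two arguments coincide, one action term has equal arguments and vanishes, and the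
  other two are opposite by antisymmetry of \<open>\<rho>\<close>; the \<open>br\<close> and
  \<open>\<psi>\<close> terms vanish by alternation.\<close>

lemma twisted_bracket_alternating: "alternating3 sP sP brP"
proof -
  have swap: "\<rho> x y m + \<rho> y x m = 0" for x y m
    using action_swap[of y x m] by simp
  show ?thesis
    using bracket_alternating cochain_alternating
    by (auto simp: alternating3_def Vector_Spaces.linear_iff twisted_bracket_def prod.scale_def zero_prod_def
        prod.p.vector_space_axioms swap
        action_add action_add_left action_add_right action_scale action_scale_left
        action_scale_right algebra_simps)
qed

lemma twisted_operator_linear: "Vector_Spaces.linear sP sP TP"
  using operator_linear module_operator_linear cochain_linear
  by (auto simp: Vector_Spaces.linear_iff twisted_operator_def prod.scale_def
      prod.p.vector_space_axioms algebra_simps)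

text \<open>The second component is additive in the module entries. The terms in \<open>m3\<close>,
  \<open>m4\<close>, \<open>m5\<close> cancel by \<open>action_action\<close>, those in
  \<open>m1\<close>, \<open>m2\<close> by \<open>action_bracket\<close>, and the terms in
  \<open>\<psi>\<close> that remain form \<open>delta2\<close>.\<close>

lemma twisted_fundamental_defect:
  "brP u1 u2 (brP u3 u4 u5)
     - (brP (brP u1 u2 u3) u4 u5 + brP u3 (brP u1 u2 u4) u5 + brP u3 u4 (brP u1 u2 u5))
   = (0, delta2 br \<rho> \<psi> (fst u1) (fst u2) (fst u3) (fst u4) (fst u5))"
proof -
  obtain x1 m1 x2 m2 x3 m3 x4 m4 x5 m5
    where u: "u1 = (x1, m1)" "u2 = (x2, m2)" "u3 = (x3, m3)" "u4 = (x4, m4)" "u5 = (x5, m5)"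
    by (metis surj_pair)
  \<comment> \<open>These instances orient the pairs as they occur in the two expansions by
    \<open>action_bracket\<close>, so that matching terms become syntactically equal.\<close>
  have swap: "\<rho> x5 x3 m = - \<rho> x3 x5 m" "\<rho> x3 x1 m = - \<rho> x1 x3 m"
    "\<rho> x4 x1 m = - \<rho> x1 x4 m" "\<rho> x5 x1 m = - \<rho> x1 x5 m"
    "\<rho> (br x3 x4 x5) x1 m = - \<rho> x1 (br x3 x4 x5) m" for m
    by (rule action_swap)+
  show ?thesis
    using action_action[of x1 x2 x3 x4 m5] action_action[of x1 x2 x4 x5 m3]
      action_action[of x1 x2 x5 x3 m4]
    by (simp add: u twisted_bracket_def delta2_def action_add action_diff action_minus swap
        action_bracket[of x2 x3 x4 x5 m1] action_bracket[of x1 x3 x4 x5 m2]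
        fundamental_identity[of x1 x2 x3 x4 x5] algebra_simps)
qed

text \<open>\<open>TP\<close> turns a module entry \<open>q\<close> over \<open>z\<close> into
  \<open>\<chi> z + TM q\<close>. The parts in \<open>m\<close>, \<open>n\<close>, \<open>q\<close>
  cancel by \<open>Rota_Baxter_action\<close> at the three cyclic pairs; the parts in
  \<open>\<chi>\<close> collect into \<open>RB_action\<close>.\<close>

lemma twisted_Rota_Baxter_defect:
  "brP (TP u) (TP v) (TP w) - TP (RB_bracket sP brP l TP u v w)
   = (0, partial1 s br l T sM \<rho> TM \<chi> (fst u) (fst v) (fst w)
          + Phi2 l T sM TM \<psi> (fst u) (fst v) (fst w))"
proof -
  obtain x m y n z q where u: "u = (x, m)" "v = (y, n)" "w = (z, q)"
    by (metis surj_pair)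
  have "fst (RB_bracket sP brP l TP u v w) = RB_bracket s br l T x y z"
    by (simp add: u RB_bracket_def twisted_bracket_def twisted_operator_def prod.scale_def)
  \<comment> \<open>Only the \<open>TM\<close> part of the outer \<open>TP\<close> is subtracted
    here. Its \<open>\<chi>\<close> part, evaluated at the bracket
    \<open>RB_bracket s br l T x y z\<close>, enters at the end and supplies the first term of
    \<open>partial1\<close>.\<close>
  moreover have "snd (brP (TP u) (TP v) (TP w)) - TM (snd (RB_bracket sP brP l TP u v w))
      = RB_action sM l T \<rho> TM x y (\<chi> z) + RB_action sM l T \<rho> TM y z (\<chi> x)
        + RB_action sM l T \<rho> TM z x (\<chi> y) + Phi2 l T sM TM \<psi> x y z"
    using Rota_Baxter_action[of x y q] Rota_Baxter_action[of y z m] Rota_Baxter_action[of z x n]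
    by (simp add: u RB_bracket_def twisted_bracket_def twisted_operator_def prod.scale_def
        RB_action_def Phi2_def action_add operator_add operator_scale algebra_simps)
  moreover have "fst (brP (TP u) (TP v) (TP w)) = T (RB_bracket s br l T x y z)"
    by (simp add: u twisted_bracket_def twisted_operator_def Rota_Baxter)
  ultimately show ?thesis
    by (simp add: u prod_eq_iff partial1_def twisted_operator_def split_beta algebra_simps)
qed

lemma twisted_algebra_iff_cocycle:
  "RB_three_Lie_algebra sP brP l TP \<longleftrightarrow> (\<psi>, \<chi>) \<in> two_cocycles s br l T sM \<rho> TM"
proof -
  \<comment> \<open>Alternation of \<open>brP\<close> and linearity of \<open>TP\<close> hold for
    every cochain, so being an algebra amounts to the vanishing of the two defects.\<close>
  have "RB_three_Lie_algebra sP brP l TP \<longleftrightarrow>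
      (\<forall>u1 u2 u3 u4 u5. brP u1 u2 (brP u3 u4 u5)
         - (brP (brP u1 u2 u3) u4 u5 + brP u3 (brP u1 u2 u4) u5 + brP u3 u4 (brP u1 u2 u5)) = 0)
      \<and> (\<forall>u v w. brP (TP u) (TP v) (TP w) - TP (RB_bracket sP brP l TP u v w) = 0)"
    using twisted_bracket_alternating twisted_operator_linear prod.p.vector_space_axioms
    by (auto simp: RB_three_Lie_algebra_def RB_three_Lie_algebra_axioms_def
        three_Lie_algebra_def three_Lie_algebra_axioms_def)
  also have "\<dots> \<longleftrightarrow>
      (\<forall>x1 x2 x3 x4 x5. delta2 br \<rho> \<psi> x1 x2 x3 x4 x5 = 0)
      \<and> (\<forall>x y z. partial1 s br l T sM \<rho> TM \<chi> x y z + Phi2 l T sM TM \<psi> x y z = 0)"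
    by (simp only: twisted_fundamental_defect twisted_Rota_Baxter_defect)
       (simp add: zero_prod_def)
  also have "\<dots> \<longleftrightarrow> (\<psi>, \<chi>) \<in> two_cocycles s br l T sM \<rho> TM"
  proof -
    \<comment> \<open>\<open>d2\<close> carries the opposite sign to the Rota-Baxter defect.\<close>
    have "- a - b = 0 \<longleftrightarrow> a + b = 0" for a b :: 'm
      by (metis minus_add_distrib neg_equal_0_iff_equal uminus_add_conv_diff add.commute)
    then show ?thesis
      using cochain_alternating cochain_linear
      by (simp add: two_cocycles_def two_cochains_def d2_def fun_eq_iff)
  qed
  finally show ?thesis .
qed

lemma inclusion_linear: "Vector_Spaces.linear sM sP (\<lambda>m. (0, m))"
  and section_linear: "Vector_Spaces.linear s sP (\<lambda>x. (x, 0))"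
  by (simp_all add: Vector_Spaces.linear_iff prod.p.vector_space_axioms vector_space_axioms
      M.vector_space_axioms prod.scale_def)

lemma module_RB_three_Lie_algebra: "RB_three_Lie_algebra sM (\<lambda>_ _ _. 0) l TM"
proof -
  have "TM 0 = 0"
    using operator_add[of 0 0] by simp
  then show ?thesis
    using module_operator_linear
    by unfold_locales (auto simp: alternating3_def Vector_Spaces.linear_iff RB_bracket_def)
qed

text \<open>Elements of \<open>M\<close> have base component \<open>0\<close>, so every term of a
  bracket with two of them has a zero base argument. This gives both the abelian condition and the
  homomorphism property of the inclusion.\<close>

lemma twisted_abelian_extension:
  assumes "RB_three_Lie_algebra sP brP l TP"
  shows "abelian_extension l sM TM sP brP TP s br T (\<lambda>m. (0, m)) fst"
proof -
  \<comment> \<open>The last two arguments coincide, so alternation applies.\<close>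
  have br_zero: "br x 0 0 = 0" and cochain_zero: "\<psi> x 0 0 = 0" for x
    using bracket_alternating cochain_alternating by (auto simp: alternating3_def)
  have action_zero_left: "\<rho> 0 x m = 0" and action_zero_right: "\<rho> x 0 m = 0" for x m
    using action_add_left[of 0 0 x m] action_add_right[of x 0 0 m] by auto
  have T_zero: "T 0 = 0" and chi_zero: "\<chi> 0 = 0"
    using operator_linear cochain_linear by (simp_all add: linear_zero)
  have "range (\<lambda>m. (0, m)) = {u :: 'g \<times> 'm. fst u = 0}"
    by force
  then show ?thesis
    using assms module_RB_three_Lie_algebra inclusion_linear prod.linear_fst
      RB_three_Lie_algebra_axioms
    by (auto simp: abelian_extension_def RB_three_Lie_hom_def twisted_bracket_def
        twisted_operator_def br_zero cochain_zero action_zero_left action_zero_right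
        T_zero chi_zero inj_def zero_prod_def)
qed

end

theorem proposition5p7:
  fixes s :: "'k::field_char_0 \<Rightarrow> 'g::ab_group_add \<Rightarrow> 'g"
    and br :: "'g \<Rightarrow> 'g \<Rightarrow> 'g \<Rightarrow> 'g"
    and l :: 'k
    and T :: "'g \<Rightarrow> 'g"
    and sM :: "'k \<Rightarrow> 'm::ab_group_add \<Rightarrow> 'm"
    and \<rho> :: "'g \<Rightarrow> 'g \<Rightarrow> 'm \<Rightarrow> 'm"
    and TM :: "'m \<Rightarrow> 'm"
    and \<psi> :: "'g \<Rightarrow> 'g \<Rightarrow> 'g \<Rightarrow> 'm"
    and \<chi> :: "'g \<Rightarrow> 'm"
  assumes "RB_three_Lie_representation s br l T sM \<rho> TM"
    and "alternating3 s sM \<psi>"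
    and "Vector_Spaces.linear s sM \<chi>"
  shows
    "(RB_three_Lie_algebra (module_prod.scale s sM)
        (twisted_bracket br \<rho> \<psi>) l (twisted_operator T TM \<chi>)
      \<longleftrightarrow> (\<psi>, \<chi>) \<in> two_cocycles s br l T sM \<rho> TM)
     \<and>
     ((\<psi>, \<chi>) \<in> two_cocycles s br l T sM \<rho> TM \<longrightarrow>
        abelian_extension l sM TM
          (module_prod.scale s sM) (twisted_bracket br \<rho> \<psi>) (twisted_operator T TM \<chi>)
          s br T (\<lambda>m. (0, m)) fst
        \<and> Vector_Spaces.linear s (module_prod.scale s sM) (\<lambda>x. (x, 0))
        \<and> fst \<circ> (\<lambda>x :: 'g. (x, 0 :: 'm)) = id
        \<and> (\<forall>x y m. twisted_bracket br \<rho> \<psi> (x, 0) (y, 0) (0, m) = (0, \<rho> x y m)))"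
proof -
  interpret RB_three_Lie_cochain s br l T sM \<rho> TM \<psi> \<chi>
    using assms by (simp add: RB_three_Lie_cochain_def RB_three_Lie_cochain_axioms_def)
  \<comment> \<open>The other two action terms act on \<open>0\<close>, while
    \<open>br x y 0\<close> and \<open>\<psi> x y 0\<close> vanish by linearity.\<close>
  have "brP (x, 0) (y, 0) (0, m) = (0, \<rho> x y m)" for x y m
    using alternating3_zero_right[OF bracket_alternating] alternating3_zero_right[OF assms(2)]
    by (simp add: twisted_bracket_def)
  then show ?thesis
    using twisted_algebra_iff_cocycle twisted_abelian_extension section_linear
    by (simp add: fun_eq_iff)
qed

end
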